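(* Let $L$ be a (nonempty) locally compact Hausdorff space. (i) If $X$ is a strictly convex real Banach space and $C_0(L,X)$ is convex-transitive, then $X$ is convex-transitive. (ii) If $H$ is a real Hilbert space with $\dim(H)=\infty$ and $C_0(L)$ is convex-transitive, then $C_0(L,H)$ is convex-transitive.
   Context: All Banach spaces are real. For a Banach space $E$, let $\mathbf{B}_E$ be its closed unit ball, $\mathbf{S}_E$ its unit sphere, and $\mathcal{G}_E$ the group of isometric automorphisms (surjective linear isometries) $T\colon E\to E$; for $x\in E$ write $\mathcal{G}_E(x)=\{T(x): T\in\mathcal{G}_E\}$. The space $E$ is called convex-transitive if $\overline{\mathrm{conv}}(\mathcal{G}_E(x))=\mathbf{B}_E$ (norm-closed convex hull) for every $x\in\mathbf{S}_E$. For a Banach space $X$, $C_0(L,X)$ is the Banach space of continuous functions $f\colon L\to X$ tending to $0$ at infinity, with norm $\|f\|=\sup_{t\in L}\|f(t)\|_X$; $C_0(L)=C_0(L,\mathbb{R})$. The Hilbert space $H$ need not be separable. *)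

theory Defs
  imports "HOL-Analysis.Analysis"
begin

section \<open>The Banach space of continuous functions vanishing at infinity\<close>

definition vanishes_at_infinity :: "('l::topological_space \<Rightarrow> 'x::real_normed_vector) \<Rightarrow> bool"
  where "vanishes_at_infinity f \<longleftrightarrow>
    (\<forall>e>0. \<exists>K. compact K \<and> (\<forall>t. t \<notin> K \<longrightarrow> norm (f t) < e))"

lemma vanishes_at_infinityD:
  assumes "vanishes_at_infinity f" "e > 0"
  obtains K where "compact K" "\<And>t. t \<notin> K \<Longrightarrow> norm (f t) < e"
  using assms unfolding vanishes_at_infinity_def by blast

lemma vanishes_at_infinity_zero: "vanishes_at_infinity (\<lambda>_. 0)"
  unfolding vanishes_at_infinity_def by (auto intro: exI[of _ "{}"])

lemma vanishes_at_infinity_add: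
  assumes "vanishes_at_infinity f" "vanishes_at_infinity g"
  shows "vanishes_at_infinity (\<lambda>t. f t + g t)"
  unfolding vanishes_at_infinity_def
proof (intro allI impI)
  fix e :: real assume "e > 0"
  then have e: "e / 2 > 0" by simp
  obtain K where K: "compact K" "\<And>t. t \<notin> K \<Longrightarrow> norm (f t) < e / 2"
    using vanishes_at_infinityD[OF assms(1) e] by blast
  obtain K' where K': "compact K'" "\<And>t. t \<notin> K' \<Longrightarrow> norm (g t) < e / 2"
    using vanishes_at_infinityD[OF assms(2) e] by blast
  have "norm (f t + g t) < e" if "t \<notin> K \<union> K'" for t
    using K(2)[of t] K'(2)[of t] norm_triangle_ineq[of "f t" "g t"] that by simp
  then show "\<exists>K. compact K \<and> (\<forall>t. t \<notin> K \<longrightarrow> norm (f t + g t) < e)"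
    using compact_Un[OF K(1) K'(1)] by blast
qed

lemma vanishes_at_infinity_scaleR:
  assumes "vanishes_at_infinity f"
  shows "vanishes_at_infinity (\<lambda>t. a *\<^sub>R f t)"
  unfolding vanishes_at_infinity_def
proof (intro allI impI)
  fix e :: real assume "e > 0"
  then have e: "e / (\<bar>a\<bar> + 1) > 0" by simp
  obtain K where K: "compact K" "\<And>t. t \<notin> K \<Longrightarrow> norm (f t) < e / (\<bar>a\<bar> + 1)"
    using vanishes_at_infinityD[OF assms(1) e] by blast
  have "norm (a *\<^sub>R f t) < e" if "t \<notin> K" for t
  proof -
    have "norm (a *\<^sub>R f t) \<le> (\<bar>a\<bar> + 1) * norm (f t)"
      by (simp add: mult_right_mono)
    also have "\<dots> < e" using K(2)[OF that] by (simp add: field_simps)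
    finally show ?thesis .
  qed
  then show "\<exists>K. compact K \<and> (\<forall>t. t \<notin> K \<longrightarrow> norm (a *\<^sub>R f t) < e)"
    using K(1) by blast
qed

lemma vanishes_at_infinity_imp_bounded:
  assumes "continuous_on UNIV f" "vanishes_at_infinity f"
  shows "bounded (range f)"
proof -
  obtain K where K: "compact K" "\<And>t. t \<notin> K \<Longrightarrow> norm (f t) < 1"
    using vanishes_at_infinityD[OF assms(2), of 1] by auto
  have "bounded (f ` K)"
    using K(1) assms(1) by (meson compact_continuous_image compact_imp_bounded
        continuous_on_subset top_greatest)
  moreover have "range f \<subseteq> f ` K \<union> cball 0 1"
    using K(2) by (force simp: less_imp_le)
  ultimately show ?thesis
    by (meson bounded_Un bounded_cball bounded_subset)
qed

typedef (overloaded) ('l, 'x) c0 =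
  "{f :: 'l::topological_space \<Rightarrow> 'x::real_normed_vector.
      continuous_on UNIV f \<and> vanishes_at_infinity f}"
  morphisms apply_c0 Abs_c0
  using vanishes_at_infinity_zero by (auto intro!: exI[of _ "\<lambda>_. 0"])

setup_lifting type_definition_c0

lemma continuous_apply_c0: "continuous_on UNIV (apply_c0 f)"
  and vanishes_apply_c0: "vanishes_at_infinity (apply_c0 f)"
  using apply_c0[of f] by auto

lemma bounded_apply_c0: "bounded (range (apply_c0 f))"
  by (rule vanishes_at_infinity_imp_bounded[OF continuous_apply_c0 vanishes_apply_c0])

lemma c0_eqI: "(\<And>t. apply_c0 f t = apply_c0 g t) \<Longrightarrow> f = g"
  by transfer auto

instantiation c0 :: (topological_space, real_normed_vector) real_vector
begin

lift_definition zero_c0 :: "('a, 'b) c0" is "\<lambda>_. 0"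
  by (simp add: vanishes_at_infinity_zero)

lift_definition plus_c0 :: "('a, 'b) c0 \<Rightarrow> ('a, 'b) c0 \<Rightarrow> ('a, 'b) c0"
  is "\<lambda>f g t. f t + g t"
  by (auto intro: continuous_intros vanishes_at_infinity_add)

lift_definition scaleR_c0 :: "real \<Rightarrow> ('a, 'b) c0 \<Rightarrow> ('a, 'b) c0"
  is "\<lambda>a f t. a *\<^sub>R f t"
  by (auto intro: continuous_intros vanishes_at_infinity_scaleR)

lift_definition uminus_c0 :: "('a, 'b) c0 \<Rightarrow> ('a, 'b) c0" is "\<lambda>f t. - f t"
  using vanishes_at_infinity_scaleR[where a="-1"] by (auto intro: continuous_intros)

lift_definition minus_c0 :: "('a, 'b) c0 \<Rightarrow> ('a, 'b) c0 \<Rightarrow> ('a, 'b) c0"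
  is "\<lambda>f g t. f t - g t"
  using vanishes_at_infinity_add vanishes_at_infinity_scaleR[where a="-1"]
  by (fastforce intro: continuous_intros)

lemmas apply_c0_simps [simp] =
  zero_c0.rep_eq plus_c0.rep_eq scaleR_c0.rep_eq uminus_c0.rep_eq minus_c0.rep_eq

instance
  by standard (auto intro!: c0_eqI simp: algebra_simps)

end

instantiation c0 :: (topological_space, real_normed_vector) real_normed_vector
begin

definition norm_c0 :: "('a, 'b) c0 \<Rightarrow> real"
  where "norm_c0 f = (SUP t. norm (apply_c0 f t))"

definition dist_c0 :: "('a, 'b) c0 \<Rightarrow> ('a, 'b) c0 \<Rightarrow> real"
  where "dist_c0 f g = norm (f - g)"

definition sgn_c0 :: "('a, 'b) c0 \<Rightarrow> ('a, 'b) c0"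
  where "sgn_c0 f = f /\<^sub>R norm f"

definition uniformity_c0 :: "(('a, 'b) c0 \<times> ('a, 'b) c0) filter"
  where "uniformity_c0 = (INF e\<in>{0 <..}. principal {(x, y). dist x y < e})"

definition open_c0 :: "('a, 'b) c0 set \<Rightarrow> bool"
  where "open_c0 S = (\<forall>x\<in>S. \<forall>\<^sub>F (x', y) in uniformity. x' = x \<longrightarrow> y \<in> S)"

lemma norm_apply_c0_le: "norm (apply_c0 f t) \<le> norm f"
  unfolding norm_c0_def
  using bounded_apply_c0[of f]
  by (intro cSUP_upper) (auto intro!: bounded_imp_bdd_above simp: bounded_norm_comp)

lemma norm_c0_le: "(\<And>t. norm (apply_c0 f t) \<le> b) \<Longrightarrow> norm f \<le> b"
  unfolding norm_c0_def by (rule cSUP_least) auto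

instance
proof
  fix a :: real and f g :: "('a, 'b) c0"
  have nonneg: "0 \<le> norm h" for h :: "('a, 'b) c0"
    using norm_ge_zero norm_apply_c0_le order_trans by blast
  show "norm f = 0 \<longleftrightarrow> f = 0"
  proof
    assume "norm f = 0"
    then show "f = 0"
      using norm_apply_c0_le[of f] by (intro c0_eqI) auto
  qed (simp add: norm_c0_def)
  show "norm (f + g) \<le> norm f + norm g"
    by (rule norm_c0_le) (auto intro!: norm_triangle_le add_mono norm_apply_c0_le)
  have le: "norm (c *\<^sub>R h) \<le> \<bar>c\<bar> * norm h" for c and h :: "('a, 'b) c0"
    by (rule norm_c0_le) (auto intro!: mult_left_mono norm_apply_c0_le)
  show "norm (a *\<^sub>R f) = \<bar>a\<bar> * norm f"
  proof (cases "a = 0")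
    case True
    then show ?thesis using le[of 0 f] nonneg[of "0 *\<^sub>R f"] by simp
  next
    case False
    then have "norm f \<le> \<bar>inverse a\<bar> * norm (a *\<^sub>R f)"
      using le[of "inverse a" "a *\<^sub>R f"] by simp
    then have "\<bar>a\<bar> * norm f \<le> norm (a *\<^sub>R f)"
      using False by (simp add: field_simps)
    then show ?thesis using le[of a f] by simp
  qed
qed (simp_all add: dist_c0_def sgn_c0_def uniformity_c0_def open_c0_def)

end

instance c0 :: (topological_space, banach) banach
proof
  fix F :: "nat \<Rightarrow> ('a, 'b) c0"
  assume F: "Cauchy F"
  have dist_apply: "dist (apply_c0 f t) (apply_c0 g t) \<le> dist f g" for f g :: "('a, 'b) c0" and t
    using norm_apply_c0_le[of "f - g" t] by (simp add: dist_norm)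
  have "\<exists>g. uniform_limit UNIV (\<lambda>n. apply_c0 (F n)) g sequentially"
    using F uniformly_convergent_eq_cauchy[of "\<lambda>_. True" "\<lambda>n. apply_c0 (F n)"]
    unfolding Cauchy_def uniform_limit_sequentially_iff
    by (metis dist_apply le_less_trans)
  then obtain g where g: "uniform_limit UNIV (\<lambda>n. apply_c0 (F n)) g sequentially" ..
  have "continuous_on UNIV g"
    by (rule uniform_limit_theorem[OF _ g]) (auto simp: continuous_apply_c0)
  moreover have "vanishes_at_infinity g"
    unfolding vanishes_at_infinity_def
  proof (intro allI impI)
    fix e :: real assume "e > 0"
    then have e: "e / 2 > 0" by simp
    obtain n where n: "\<And>t. dist (apply_c0 (F n) t) (g t) < e / 2"
      using uniform_limitD[OF g e] unfolding eventually_sequentially by blast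
    obtain K where K: "compact K" "\<And>t. t \<notin> K \<Longrightarrow> norm (apply_c0 (F n) t) < e / 2"
      using vanishes_at_infinityD[OF vanishes_apply_c0 e] by blast
    have "norm (g t) < e" if "t \<notin> K" for t
      using n[of t] K(2)[OF that] norm_triangle_sub[of "g t" "apply_c0 (F n) t"]
      by (simp add: dist_norm norm_minus_commute)
    then show "\<exists>K. compact K \<and> (\<forall>t. t \<notin> K \<longrightarrow> norm (g t) < e)"
      using K(1) by blast
  qed
  ultimately have ag: "apply_c0 (Abs_c0 g) = g"
    by (simp add: Abs_c0_inverse)
  have "F \<longlonglongrightarrow> Abs_c0 g"
  proof (rule tendstoI)
    fix e :: real assume "e > 0"
    then have e: "e / 2 > 0" by simp
    from uniform_limitD[OF g e]
    have "\<forall>\<^sub>F n in sequentially. dist (F n) (Abs_c0 g) \<le> e / 2"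
    proof eventually_elim
      case (elim n)
      have "norm (apply_c0 (F n - Abs_c0 g) t) \<le> e / 2" for t
        using elim by (simp add: ag dist_norm less_imp_le)
      then show ?case
        unfolding dist_c0_def by (rule norm_c0_le)
    qed
    then show "\<forall>\<^sub>F n in sequentially. dist (F n) (Abs_c0 g) < e"
      by eventually_elim (use \<open>e > 0\<close> in auto)
  qed
  then show "convergent F" by (rule convergentI)
qed

section \<open>Convex-transitivity\<close>

definition isometric_automorphisms :: "('e::real_normed_vector \<Rightarrow> 'e) set"
  where "isometric_automorphisms = {T. linear T \<and> surj T \<and> (\<forall>x. norm (T x) = norm x)}"

definition isometry_orbit :: "'e::real_normed_vector \<Rightarrow> 'e set"
  where "isometry_orbit x = {T x | T. T \<in> isometric_automorphisms}"

definition convex_transitive :: "'e::banach itself \<Rightarrow> bool"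
  where "convex_transitive _ \<longleftrightarrow>
    (\<forall>x\<in>sphere (0::'e) 1. closure (convex hull (isometry_orbit x)) = cball 0 1)"

definition strictly_convex :: "'e::banach itself \<Rightarrow> bool"
  where "strictly_convex _ \<longleftrightarrow>
    (\<forall>x\<in>sphere (0::'e) 1. \<forall>y\<in>sphere 0 1. x \<noteq> y \<longrightarrow> norm (midpoint x y) < 1)"

text \<open>The library's \<open>dim\<close> is \<open>0\<close> for spaces without a finite basis, so it
  cannot express infinite dimension.\<close>

definition infinite_dimensional :: "'e::real_vector itself \<Rightarrow> bool"
  where "infinite_dimensional _ \<longleftrightarrow> (\<nexists>B::'e set. finite B \<and> span B = UNIV)"

end

theory Submission
  imports Defs
begin

text \<open>
  Both halves rest on the pointwise form of the surjective isometries of \<open>C\<^sub>0(L,X)\<close> for strictly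
  convex \<open>X\<close> (Jerison's extension of the Banach--Stone theorem, \<open>banach_stone_strictly_convex\<close>):
  at every point \<open>t\<close> there are a point \<open>s\<close> and an isometric automorphism \<open>\<sigma>\<close> of \<open>X\<close> with
  \<open>T f t = \<sigma> (f s)\<close> for all \<open>f\<close>. The reason is that a convex subset of the unit sphere of
  \<open>C\<^sub>0(L,X)\<close> peaks at a common point with a common value, so that \<open>T\<close> permutes the sets
  \<open>{f. norm f \<le> 1 \<and> f t = x}\<close> with \<open>x\<close> a unit vector.

  For the first claim, take a peak function \<open>g\<close> with \<open>g t = 1\<close>. Convex combinations of functions
  \<open>T (g \<otimes> x)\<close> approximate \<open>g \<otimes> y\<close>; their values at \<open>t\<close> are convex combinations of vectors
  \<open>c \<sigma>(x)\<close> with \<open>0 \<le> c \<le> 1\<close>, and such a vector lies on the segment from \<open>-\<sigma>(x)\<close> to \<open>\<sigma>(x)\<close>.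

  For the second claim, the case \<open>X = \<real>\<close> shows that every automorphism of \<open>C\<^sub>0(L)\<close> is a signed composition
  operator, and the same formula defines an automorphism of \<open>C\<^sub>0(L,H)\<close>
  (\<open>isometric_automorphism_extension\<close>). Thus convex-transitivity of \<open>C\<^sub>0(L)\<close> already
  handles functions of the form \<open>g \<otimes> e\<close> with a fixed unit vector \<open>e\<close>. General functions are
  brought to this form up to a small error: since the range of \<open>F\<close> is totally bounded and
  \<open>dim H = \<infinity>\<close>, some unit vector \<open>e\<close> is almost orthogonal to the range, and a continuous family of
  reflections then turns \<open>F\<close> into nearly \<open>\<bar>F\<bar> \<otimes> e\<close> (\<open>straightening_automorphism\<close>). The source
  and the target are straightened towards the same \<open>e\<close>.
\<close>

section \<open>Building functions vanishing at infinity\<close>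

lemma vanishes_at_infinity_dominated:
  assumes "vanishes_at_infinity f" and le: "\<And>t. norm (g t) \<le> norm (f t)"
  shows "vanishes_at_infinity g"
  using assms(1) unfolding vanishes_at_infinity_def by (meson le le_less_trans)

lift_definition c0_tensor :: "('l::topological_space, real) c0 \<Rightarrow> 'x::real_normed_vector \<Rightarrow> ('l, 'x) c0"
  is "\<lambda>g x t. g t *\<^sub>R x"
proof -
  fix g :: "'l \<Rightarrow> real" and x :: 'x
  assume g: "continuous_on UNIV g \<and> vanishes_at_infinity g"
  then have "vanishes_at_infinity (\<lambda>t. norm x *\<^sub>R g t)"
    by (blast intro: vanishes_at_infinity_scaleR)
  then have "vanishes_at_infinity (\<lambda>t. g t *\<^sub>R x)"
    by (rule vanishes_at_infinity_dominated) (simp add: mult.commute)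
  then show "continuous_on UNIV (\<lambda>t. g t *\<^sub>R x) \<and> vanishes_at_infinity (\<lambda>t. g t *\<^sub>R x)"
    using g by (auto intro!: continuous_intros)
qed

lift_definition c0_mult :: "('l::topological_space, real) c0 \<Rightarrow> ('l, 'x::real_normed_vector) c0 \<Rightarrow> ('l, 'x) c0"
  is "\<lambda>g f t. g t *\<^sub>R f t"
proof -
  fix g :: "'l \<Rightarrow> real" and f :: "'l \<Rightarrow> 'x"
  assume g: "continuous_on UNIV g \<and> vanishes_at_infinity g"
    and f: "continuous_on UNIV f \<and> vanishes_at_infinity f"
  then have "bounded (range g)"
    by (blast intro: vanishes_at_infinity_imp_bounded)
  then obtain b where b: "\<And>t. norm (g t) \<le> b"
    by (auto simp: bounded_iff)
  have "vanishes_at_infinity (\<lambda>t. b *\<^sub>R f t)"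
    using f by (blast intro: vanishes_at_infinity_scaleR)
  then have "vanishes_at_infinity (\<lambda>t. g t *\<^sub>R f t)"
  proof (rule vanishes_at_infinity_dominated)
    fix t show "norm (g t *\<^sub>R f t) \<le> norm (b *\<^sub>R f t)"
      using b[of t] by (auto intro!: mult_right_mono)
  qed
  then show "continuous_on UNIV (\<lambda>t. g t *\<^sub>R f t) \<and> vanishes_at_infinity (\<lambda>t. g t *\<^sub>R f t)"
    using g f by (auto intro!: continuous_intros)
qed

lift_definition c0_norm :: "('l::topological_space, 'x::real_normed_vector) c0 \<Rightarrow> ('l, real) c0"
  is "\<lambda>f t. norm (f t)"
  by (auto intro!: continuous_intros elim: vanishes_at_infinity_dominated)

lift_definition c0_inner :: "('l::topological_space, 'h::real_inner) c0 \<Rightarrow> 'h \<Rightarrow> ('l, real) c0"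
  is "\<lambda>f h t. inner (f t) h"
proof -
  fix f :: "'l \<Rightarrow> 'h" and h :: 'h
  assume f: "continuous_on UNIV f \<and> vanishes_at_infinity f"
  then have "vanishes_at_infinity (\<lambda>t. norm h *\<^sub>R f t)"
    by (blast intro: vanishes_at_infinity_scaleR)
  then have "vanishes_at_infinity (\<lambda>t. inner (f t) h)"
    by (rule vanishes_at_infinity_dominated) (use Cauchy_Schwarz_ineq2 in \<open>simp add: mult.commute[of "norm h"]\<close>)
  then show "continuous_on UNIV (\<lambda>t. inner (f t) h) \<and> vanishes_at_infinity (\<lambda>t. inner (f t) h)"
    using f by (auto intro!: continuous_intros)
qed

lemmas c0_apply_simps [simp] =
  c0_tensor.rep_eq c0_mult.rep_eq c0_norm.rep_eq c0_inner.rep_eq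

lemma linear_c0_tensor_left: "linear (\<lambda>g. c0_tensor g x)"
  by (intro linearI c0_eqI) (simp_all add: scaleR_add_left)

lemma linear_c0_tensor_right: "linear (c0_tensor g)"
  by (intro linearI c0_eqI) (simp_all add: scaleR_add_right)

lemma linear_apply_c0: "linear (\<lambda>f. apply_c0 f t)"
  by (intro linearI) simp_all

lemma bounded_linear_apply_c0: "bounded_linear (\<lambda>f. apply_c0 f t)"
  by (intro bounded_linear_intro[where K = 1]) (simp_all add: norm_apply_c0_le)

lemma norm_c0_tensor_le: "norm (c0_tensor g x) \<le> norm g * norm x"
  by (rule norm_c0_le) (auto intro!: mult_right_mono simp: norm_apply_c0_le[where 'b = real, simplified])

lemma norm_c0_norm: "norm (c0_norm f) = norm f"
  by (simp add: norm_c0_def)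

text \<open>Vanishing at infinity makes the supremum norm a maximum; this is what lets a norm
  identity for functions be read off at a single point.\<close>

lemma c0_norm_attained:
  assumes "norm f = 1"
  obtains t where "norm (apply_c0 f t) = 1"
proof -
  obtain K where K: "compact K" "\<And>t. t \<notin> K \<Longrightarrow> norm (apply_c0 f t) < 1/2"
    using vanishes_at_infinityD[OF vanishes_apply_c0, of "1/2" f] by auto
  have "K \<noteq> {}"
  proof
    assume "K = {}"
    then have "norm f \<le> 1/2"
      using K(2) by (intro norm_c0_le) (simp add: less_imp_le)
    with assms show False by simp
  qed
  moreover have "continuous_on K (\<lambda>t. norm (apply_c0 f t))"
    using continuous_on_subset[OF continuous_apply_c0] by (intro continuous_on_norm) blast
  ultimately obtain s where s: "\<And>t. t \<in> K \<Longrightarrow> norm (apply_c0 f t) \<le> norm (apply_c0 f s)"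
    using continuous_attains_sup[OF K(1)] by blast
  have "norm f \<le> max (1/2) (norm (apply_c0 f s))"
    using s K(2) by (intro norm_c0_le) (metis less_imp_le max.coboundedI1 max.coboundedI2)
  with assms have "norm (apply_c0 f s) = 1"
    using norm_apply_c0_le[of f s] by simp
  then show thesis by (rule that)
qed

lemma Hausdorff_space_euclidean_t2: "Hausdorff_space (euclidean :: 'a::t2_space topology)"
  unfolding Hausdorff_space_def
proof (intro allI impI, elim conjE)
  fix x y :: 'a assume "x \<noteq> y"
  from hausdorff[OF this] obtain U V where "open U" "open V" "x \<in> U" "y \<in> V" "U \<inter> V = {}"
    by (elim exE conjE)
  then show "\<exists>U V. openin euclidean U \<and> openin euclidean V \<and> x \<in> U \<and> y \<in> V \<and> disjnt U V"
    by (intro exI[of _ U] exI[of _ V]) (simp add: disjnt_def)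
qed

text \<open>Complete regularity is applied to the part of \<open>U\<close> inside a relatively compact neighbourhood of
  \<open>t\<close>, so that the bump vanishes outside a compact set.\<close>

lemma c0_bump:
  fixes t :: "'l::t2_space"
  assumes lc: "locally_compact_space (euclidean :: 'l topology)" and U: "open U" "t \<in> U"
  obtains g :: "('l, real) c0"
  where "apply_c0 g t = 1" "\<And>s. 0 \<le> apply_c0 g s" "\<And>s. apply_c0 g s \<le> 1"
    "\<And>s. s \<notin> U \<Longrightarrow> apply_c0 g s = 0"
proof -
  obtain V K where V: "open V" "compact K" "t \<in> V" "V \<subseteq> K"
    using lc unfolding locally_compact_space_def by (simp flip: open_openin) blast
  have "completely_regular_space (euclidean :: 'l topology)"
    using lc Hausdorff_space_euclidean_t2
    by (intro locally_compact_regular_imp_completely_regular_space) auto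
  moreover have "closedin euclidean (- (U \<inter> V))"
    using U V by (auto simp flip: closed_closedin)
  moreover have "t \<in> topspace euclidean - - (U \<inter> V)"
    using U V by simp
  ultimately obtain f where f: "continuous_map euclidean (top_of_set {0..1::real}) f" "f t = 0"
      "f ` (- (U \<inter> V)) \<subseteq> {1}"
    unfolding completely_regular_space_def by blast
  have cf: "continuous_on UNIV f" and f01: "\<And>s. f s \<in> {0..1}"
    using f(1) by (auto simp: continuous_map_in_subtopology)
  have out: "f s = 1" if "s \<notin> U \<or> s \<notin> V" for s
    using f(3) that by blast
  let ?g = "\<lambda>s. 1 - f s"
  have "vanishes_at_infinity ?g"
    unfolding vanishes_at_infinity_def using V out by (metis diff_self norm_zero subsetD)
  then have "apply_c0 (Abs_c0 ?g) = ?g"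
    using cf by (simp add: Abs_c0_inverse continuous_intros)
  then show thesis
    using that[of "Abs_c0 ?g"] f(2) f01 out by auto
qed

section \<open>Isometric automorphisms\<close>

lemma isometric_automorphismsD:
  assumes "T \<in> isometric_automorphisms"
  shows "linear T" "surj T" "norm (T x) = norm x" "inv T \<in> isometric_automorphisms"
    "T (inv T x) = x" "inv T (T x) = x"
proof -
  have T: "linear T" "surj T" and nT: "\<And>x. norm (T x) = norm x"
    using assms unfolding isometric_automorphisms_def by blast+
  have inj: "inj T"
    unfolding linear_injective_0[OF T(1)] using nT norm_eq_zero by metis
  have i: "\<And>x. T (inv T x) = x" "\<And>x. inv T (T x) = x"
    using T(2) inj by (simp_all add: surj_f_inv_f)
  have "linear (inv T)"
  proof (rule linearI)
    fix x y c
    have "T (inv T x + inv T y) = x + y" by (simp add: linear_add[OF T(1)] i(1))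
    then show "inv T (x + y) = inv T x + inv T y" using i(2) by metis
    have "T (c *\<^sub>R inv T x) = c *\<^sub>R x" by (simp add: linear_scale[OF T(1)] i(1))
    then show "inv T (c *\<^sub>R x) = c *\<^sub>R inv T x" using i(2) by metis
  qed
  moreover have "norm (inv T x) = norm x" for x
    using nT[of "inv T x"] by (simp add: i(1))
  moreover have "surj (inv T)"
    using i(2) by (rule surjI)
  ultimately show "inv T \<in> isometric_automorphisms"
    by (simp add: isometric_automorphisms_def)
  show "linear T" "surj T" "norm (T x) = norm x" "T (inv T x) = x" "inv T (T x) = x"
    using T nT i by simp_all
qed

lemma isometric_automorphismsI:
  assumes "linear T" "\<And>x. norm (T x) = norm x" "\<And>x. T (S x) = x"
  shows "T \<in> isometric_automorphisms"
  using assms surjI[of T S] unfolding isometric_automorphisms_def by auto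

lemma isometric_automorphisms_comp:
  assumes "S \<in> isometric_automorphisms" "T \<in> isometric_automorphisms"
  shows "S \<circ> T \<in> isometric_automorphisms"
proof (rule isometric_automorphismsI[where S = "\<lambda>x. inv T (inv S x)"])
  show "linear (S \<circ> T)"
    using assms by (intro linear_compose) (simp_all add: isometric_automorphismsD)
qed (simp_all add: isometric_automorphismsD[OF assms(1)] isometric_automorphismsD[OF assms(2)])

lemma uminus_isometric_automorphism:
  assumes "T \<in> isometric_automorphisms"
  shows "(\<lambda>x. - T x) \<in> isometric_automorphisms"
proof (rule isometric_automorphismsI[where S = "\<lambda>x. inv T (- x)"])
  show "linear (\<lambda>x. - T x)"
    using isometric_automorphismsD(1)[OF assms] by (rule linear_compose_neg)
qed (simp_all add: isometric_automorphismsD[OF assms])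

lemma isometry_orbit_image_subset:
  assumes "T \<in> isometric_automorphisms"
  shows "T ` isometry_orbit x \<subseteq> isometry_orbit x"
  proof
  fix z assume "z \<in> T ` isometry_orbit x"
  then obtain S where S: "S \<in> isometric_automorphisms" and z: "z = (T \<circ> S) x"
    unfolding isometry_orbit_def by auto
  with isometric_automorphisms_comp[OF assms S] show "z \<in> isometry_orbit x"
    unfolding isometry_orbit_def by blast
qed

lemma image_convex_hull_orbit_subset:
  assumes "T \<in> isometric_automorphisms"
  shows "T ` (convex hull isometry_orbit x) \<subseteq> convex hull isometry_orbit x"
  by (simp add: convex_hull_linear_image isometric_automorphismsD[OF assms] hull_mono
      isometry_orbit_image_subset[OF assms])

lemma isometry_orbit_of_image_subset:
  assumes "T \<in> isometric_automorphisms"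
  shows "isometry_orbit (T x) \<subseteq> isometry_orbit x"
  proof
  fix z assume "z \<in> isometry_orbit (T x)"
  then obtain S where S: "S \<in> isometric_automorphisms" and z: "z = (S \<circ> T) x"
    unfolding isometry_orbit_def by auto
  with isometric_automorphisms_comp[OF S assms] show "z \<in> isometry_orbit x"
    unfolding isometry_orbit_def by blast
qed

lemma convex_hull_orbit_subset_cball:
  assumes "norm x \<le> 1"
  shows "closure (convex hull isometry_orbit x) \<subseteq> cball 0 1"
proof (intro closure_minimal hull_minimal)
  show "isometry_orbit x \<subseteq> cball 0 1"
    using assms by (auto simp: isometry_orbit_def isometric_automorphismsD(3))
qed auto

lemma convex_transitiveI:
  assumes "\<And>x y. norm (x::'e::banach) = 1 \<Longrightarrow> norm y \<le> 1 \<Longrightarrow> y \<in> closure (convex hull isometry_orbit x)"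
  shows "convex_transitive TYPE('e)"
  unfolding convex_transitive_def
proof
  fix x :: 'e assume "x \<in> sphere 0 1"
  then show "closure (convex hull isometry_orbit x) = cball 0 1"
    using convex_hull_orbit_subset_cball[of x] assms[of x] by auto
qed

text \<open>The orbit of a nearby vector consists of nearby points, and this survives convex combinations.\<close>

lemma convex_hull_orbit_perturb:
  assumes d: "norm (u - u') \<le> d" and v: "v \<in> convex hull isometry_orbit u"
  obtains v' where "v' \<in> convex hull isometry_orbit u'" "norm (v - v') \<le> d"
proof -
  let ?H = "convex hull isometry_orbit u'"
  let ?P = "{a + b | a b. a \<in> ?H \<and> b \<in> cball 0 d}"
  have "convex ?P"
  proof -
    have "?P = (\<Union>a\<in>?H. \<Union>b\<in>cball 0 d. {a + b})" by blast
    then show ?thesis by (simp add: convex_sums)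
  qed
  moreover have "isometry_orbit u \<subseteq> ?P"
  proof
    fix z assume "z \<in> isometry_orbit u"
    then obtain T where T: "T \<in> isometric_automorphisms" and z: "z = T u"
      unfolding isometry_orbit_def by blast
    have "T u' \<in> ?H"
      using T by (intro hull_inc) (auto simp: isometry_orbit_def)
    moreover have "norm (T u - T u') \<le> d"
      using d isometric_automorphismsD(3)[OF T, of "u - u'"]
      by (simp add: linear_diff[OF isometric_automorphismsD(1)[OF T]])
    moreover have "z = T u' + (T u - T u')" using z by simp
    ultimately show "z \<in> ?P" by fastforce
  qed
  ultimately have "v \<in> ?P"
    using v hull_minimal[of "isometry_orbit u" ?P convex] by blast
  then show thesis using that by fastforce
qed

section \<open>Faces of the unit ball and the Banach--Stone theorem\<close>

lemma strictly_convex_norm_midpoint_eq_1: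
  fixes x y :: "'x::banach"
  assumes sc: "strictly_convex TYPE('x)" and x: "norm x \<le> 1" and y: "norm y \<le> 1"
    and m: "norm (midpoint x y) = 1"
  shows "x = y"
proof -
  have "norm (midpoint x y) \<le> (norm x + norm y) / 2"
    using norm_triangle_ineq[of x y] by (simp add: midpoint_def)
  with x y m have "norm x = 1" "norm y = 1" by simp_all
  with sc m show ?thesis
    unfolding strictly_convex_def by (metis less_irrefl mem_sphere_0)
qed

lemma apply_c0_midpoint:
  "apply_c0 (midpoint f g) t = midpoint (apply_c0 f t) (apply_c0 g t)"
  by (simp add: midpoint_def)

lemma strictly_convex_real: "strictly_convex TYPE(real)"
  unfolding strictly_convex_def by (auto simp: midpoint_def abs_if split: if_splits)

text \<open>For unit vectors \<open>x\<close> in a strictly convex space, over a locally compact Hausdorff base, these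
  are the maximal convex subsets of the unit sphere; that is what makes them accessible to
  isometries.\<close>

definition c0_face :: "'l::topological_space \<Rightarrow> 'x::real_normed_vector \<Rightarrow> ('l, 'x) c0 set"
  where "c0_face t x = {f. norm f \<le> 1 \<and> apply_c0 f t = x}"

lemma convex_c0_face: "convex (c0_face t x)"
proof -
  have "c0_face t x = cball 0 1 \<inter> (\<lambda>f. apply_c0 f t) -` {x}"
    by (auto simp: c0_face_def)
  then show ?thesis
    by (simp add: convex_Int convex_linear_vimage linear_apply_c0)
qed

lemma c0_face_subset_sphere: "norm x = 1 \<Longrightarrow> c0_face t x \<subseteq> sphere 0 1"
  unfolding c0_face_def by clarsimp (metis norm_apply_c0_le order_antisym)

text \<open>At a point where a suitable convex combination of finitely many members of the set attains its
  norm, strict convexity makes all of them take one and the same unit value. The set of points where a fixed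
  member has norm one is compact, so the finite intersection property yields a point that serves
  all members simultaneously.\<close>

lemma convex_subset_sphere_in_c0_face:
  fixes C :: "('l::t2_space, 'x::banach) c0 set"
  assumes sc: "strictly_convex TYPE('x)" and C: "convex C" "C \<subseteq> sphere 0 1"
    and f0: "f0 \<in> C"
  obtains t x where "norm x = 1" "C \<subseteq> c0_face t x"
proof -
  (* Midpoints are taken successively, since strict convexity speaks of pairs only. *)
  have avg: "\<exists>h\<in>C. \<forall>t. norm (apply_c0 h t) = 1 \<longrightarrow> (\<forall>f\<in>A. apply_c0 f t = apply_c0 h t)"
    if "finite A" "A \<subseteq> C" for A
    using that
  proof (induction A rule: finite_induct)
    case empty
    with f0 show ?case by blast
  next
    case (insert f A)
    then obtain h where h: "h \<in> C"
        "\<And>t g. norm (apply_c0 h t) = 1 \<Longrightarrow> g \<in> A \<Longrightarrow> apply_c0 g t = apply_c0 h t"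
      by auto
    have f: "f \<in> C" using insert by simp
    have le: "norm (apply_c0 g t) \<le> 1" if "g \<in> C" for g t
      using norm_apply_c0_le[of g t] C(2) that by auto
    have eq: "apply_c0 h t = apply_c0 f t" if "norm (apply_c0 (midpoint h f) t) = 1" for t
      using that unfolding apply_c0_midpoint
      by (intro strictly_convex_norm_midpoint_eq_1[OF sc le[OF h(1)] le[OF f]])
    show ?case
    proof (intro bexI[of _ "midpoint h f"] allI impI ballI)
      show "midpoint h f \<in> C"
        using closed_segment_subset[OF h(1) f C(1)] by auto
      fix t g assume t: "norm (apply_c0 (midpoint h f) t) = 1" and g: "g \<in> insert f A"
      have m: "apply_c0 (midpoint h f) t = apply_c0 h t"
        using eq[OF t] by (simp add: apply_c0_midpoint)
      with t have "norm (apply_c0 h t) = 1" by simp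
      with g h(2) eq[OF t] m show "apply_c0 g t = apply_c0 (midpoint h f) t"
        by auto
    qed
  qed
  have nm: "norm f = 1" if "f \<in> C" for f
    using that C(2) by auto
  obtain K where K: "compact K" "\<And>t. t \<notin> K \<Longrightarrow> norm (apply_c0 f0 t) < 1"
    using vanishes_at_infinityD[OF vanishes_apply_c0, of 1 f0] by auto
  define E where "E f = {t. apply_c0 f t = apply_c0 f0 t} \<inter> {t. norm (apply_c0 f0 t) = 1}" for f
  have "K \<inter> (\<Inter>f\<in>C. E f) \<noteq> {}"
  proof (rule compact_imp_fip_image[OF K(1)])
    show "closed (E f)" for f
      unfolding E_def
      by (intro closed_Int closed_Collect_eq continuous_on_norm continuous_apply_c0 continuous_on_const)
  next
    fix A assume "finite A" "A \<subseteq> C"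
    with f0 avg[of "insert f0 A"] obtain h where h: "h \<in> C"
        "\<And>t f. norm (apply_c0 h t) = 1 \<Longrightarrow> f \<in> insert f0 A \<Longrightarrow> apply_c0 f t = apply_c0 h t"
      by auto
    obtain t where t: "norm (apply_c0 h t) = 1"
      using c0_norm_attained[OF nm[OF h(1)]] .
    have "norm (apply_c0 f0 t) = 1"
      using h(2)[OF t] t by simp
    moreover from this have "t \<in> K" using K(2)[of t] by force
    ultimately have "t \<in> K \<inter> (\<Inter>f\<in>A. E f)"
      using h(2)[OF t] unfolding E_def by auto
    then show "K \<inter> (\<Inter>f\<in>A. E f) \<noteq> {}" by blast
  qed
  then obtain t where t: "\<And>f. f \<in> C \<Longrightarrow> t \<in> E f" by blast
  show thesis
  proof (rule that)
    show "norm (apply_c0 f0 t) = 1" using t[OF f0] by (simp add: E_def)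
    show "C \<subseteq> c0_face t (apply_c0 f0 t)"
      using t nm by (auto simp: E_def c0_face_def)
  qed
qed

context
  assumes lc: "locally_compact_space (euclidean :: 'l::t2_space topology)"
begin

lemma c0_face_nonempty:
  assumes "norm (x :: 'x::real_normed_vector) \<le> 1"
  shows "c0_face (t::'l) x \<noteq> {}"
proof -
  obtain g :: "('l, real) c0" where g: "apply_c0 g t = 1" "\<And>s. 0 \<le> apply_c0 g s" "\<And>s. apply_c0 g s \<le> 1"
    using c0_bump[OF lc open_UNIV, of t] by auto
  have "norm (c0_tensor g x) \<le> 1"
    using g(2,3) assms by (intro norm_c0_le) (simp add: mult_le_one)
  then have "c0_tensor g x \<in> c0_face t x"
    using g(1) by (simp add: c0_face_def)
  then show ?thesis by blast
qed

lemma c0_faces_meet: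
  assumes "(s::'l) \<noteq> t" "norm (x :: 'x::real_normed_vector) \<le> 1" "norm y \<le> 1"
  shows "c0_face s x \<inter> c0_face t y \<noteq> {}"
proof -
  obtain U V where U: "open U" "open V" "s \<in> U" "t \<in> V" "U \<inter> V = {}"
    using hausdorff[OF assms(1)] by blast
  obtain g :: "('l, real) c0" where g: "apply_c0 g s = 1" "\<And>s. 0 \<le> apply_c0 g s" "\<And>s. apply_c0 g s \<le> 1"
      "\<And>s. s \<notin> U \<Longrightarrow> apply_c0 g s = 0"
    using c0_bump[OF lc U(1,3)] by auto
  obtain h :: "('l, real) c0" where h: "apply_c0 h t = 1" "\<And>s. 0 \<le> apply_c0 h s" "\<And>s. apply_c0 h s \<le> 1"
      "\<And>s. s \<notin> V \<Longrightarrow> apply_c0 h s = 0"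
    using c0_bump[OF lc U(2,4)] by auto
  let ?f = "c0_tensor g x + c0_tensor h y"
  have "norm ?f \<le> 1"
  proof (rule norm_c0_le)
    fix r
    show "norm (apply_c0 ?f r) \<le> 1"
    proof (cases "r \<in> U")
      case True
      then have "apply_c0 h r = 0" using U h(4) by blast
      then show ?thesis using g(2,3) assms(2) by (simp add: mult_le_one)
    next
      case False
      then have "apply_c0 g r = 0" using g(4) by blast
      then show ?thesis using h(2,3) assms(3) by (simp add: mult_le_one)
    qed
  qed
  moreover have "apply_c0 g t = 0" "apply_c0 h s = 0"
    using g(4) h(4) U by blast+
  ultimately have "?f \<in> c0_face s x \<inter> c0_face t y"
    using g(1) h(1) by (simp add: c0_face_def)
  then show ?thesis by blast
qed

lemma c0_face_subset_imp_eq: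
  assumes "norm (x :: 'x::real_normed_vector) = 1" "norm y = 1" and sub: "c0_face s x \<subseteq> c0_face (t::'l) y"
  shows "s = t \<and> x = y"
proof -
  have "s = t"
  proof (rule ccontr)
    assume "s \<noteq> t"
    then have "c0_face s x \<inter> c0_face t (-y) \<noteq> {}"
      using assms by (intro c0_faces_meet) auto
    with sub have "y = - y" by (auto simp: c0_face_def)
    then have "y = 0" by (metis add.right_inverse equation_minus_iff scaleR_2 scaleR_eq_0_iff zero_neq_numeral)
    with assms(2) show False by simp
  qed
  moreover obtain f where "f \<in> c0_face s x"
    using c0_face_nonempty[of x s] assms(1) by auto
  ultimately show ?thesis
    using sub by (auto simp: c0_face_def)
qed

text \<open>Both the automorphism and its inverse map faces into faces, and distinct faces are not
  nested; hence faces go onto faces.\<close>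

lemma isometric_automorphism_c0_face:
  fixes x :: "'x::banach"
  assumes sc: "strictly_convex TYPE('x)" and T: "T \<in> isometric_automorphisms" and x: "norm x = 1"
  obtains s y where "norm y = 1" "T ` c0_face t x = c0_face (s::'l) y"
proof -
  have into: "\<exists>s y. norm y = 1 \<and> S ` c0_face t x \<subseteq> c0_face s y"
    if S: "S \<in> isometric_automorphisms" and x: "norm x = 1"
    for S and t :: 'l and x :: 'x
  proof -
    obtain f0 where "f0 \<in> c0_face t x"
      using c0_face_nonempty[of x t] x by auto
    moreover have "convex (S ` c0_face t x)"
      by (intro convex_linear_image convex_c0_face isometric_automorphismsD(1)[OF S])
    moreover have "S ` c0_face t x \<subseteq> sphere 0 1"
      using c0_face_subset_sphere[OF x, of t] by (auto simp: isometric_automorphismsD(3)[OF S])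
    ultimately show ?thesis
      using convex_subset_sphere_in_c0_face[OF sc, of "S ` c0_face t x" "S f0"] by blast
  qed
  obtain s y where y: "norm y = 1" and sub: "T ` c0_face t x \<subseteq> c0_face s y"
    using into[OF T x] by blast
  obtain r z where z: "norm z = 1" and sub': "inv T ` c0_face s y \<subseteq> c0_face r z"
    using into[OF isometric_automorphismsD(4)[OF T] y] by blast
  have "c0_face t x \<subseteq> c0_face r z"
  proof
    fix f assume "f \<in> c0_face t x"
    with sub sub' have "inv T (T f) \<in> c0_face r z" by blast
    then show "f \<in> c0_face r z" by (simp add: isometric_automorphismsD(6)[OF T])
  qed
  then have "r = t" "z = x"
    using c0_face_subset_imp_eq[OF x z] by blast+
  have "c0_face s y \<subseteq> T ` c0_face t x"
  proof
    fix f assume "f \<in> c0_face s y"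
    with sub' have "inv T f \<in> c0_face t x" unfolding \<open>r = t\<close> \<open>z = x\<close> by blast
    then show "f \<in> T ` c0_face t x"
      using isometric_automorphismsD(5)[OF T, of f] by (metis image_eqI)
  qed
  with sub y show thesis using that by blast
qed

text \<open>The base point of the image face depends on the base point alone: two faces at one point
  with different values are disjoint, whereas faces at different points always meet.\<close>

lemma isometric_automorphism_moves_points:
  assumes sc: "strictly_convex TYPE('x::banach)" and T: "T \<in> isometric_automorphisms"
  obtains s where "\<And>x::'x. norm x = 1 \<Longrightarrow> \<exists>y. norm y = 1 \<and> T ` c0_face t x = c0_face (s::'l) y"
proof (cases "\<exists>x::'x. norm x = 1")
  case False
  then show thesis using that by blast
next
  case True
  then obtain x0 :: 'x where x0: "norm x0 = 1" by blast
  obtain s y0 where y0: "norm y0 = 1" and s: "T ` c0_face t x0 = c0_face s y0"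
    using isometric_automorphism_c0_face[OF sc T x0] .
  show thesis
  proof (rule that)
    fix x :: 'x assume x: "norm x = 1"
    obtain r y where y: "norm y = 1" and r: "T ` c0_face t x = c0_face r y"
      using isometric_automorphism_c0_face[OF sc T x] .
    have "r = s"
    proof (rule ccontr)
      assume "r \<noteq> s"
      then obtain f where f: "f \<in> c0_face r y" "f \<in> c0_face s y0"
        using c0_faces_meet[of r s y y0] y y0 by auto
      then obtain g h where "g \<in> c0_face t x" "f = T g" "h \<in> c0_face t x0" "f = T h"
        using r s by blast
      then have "x = x0"
        using isometric_automorphismsD(6)[OF T] by (metis (mono_tags, lifting) c0_face_def mem_Collect_eq)
      with r s have "c0_face r y = c0_face s y0" by simp
      with c0_face_subset_imp_eq[OF y y0] \<open>r \<noteq> s\<close> show False by blast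
    qed
    with y r show "\<exists>y. norm y = 1 \<and> T ` c0_face t x = c0_face s y" by blast
  qed
qed

text \<open>Let \<open>f\<close> be in the unit ball with \<open>f t = 0\<close>, and let \<open>g\<close> be a bump at \<open>t\<close> that lives where
  \<open>f\<close> is small. Then \<open>g \<otimes> x\<close> and \<open>g \<otimes> x + (1 - g) f\<close> both belong to the face at \<open>t\<close>, the latter
  because its pointwise norm is at most \<open>g + (1 - g)\<close>. Their images agree at \<open>s\<close>, so the image of
  \<open>(1 - g) f\<close> vanishes there, and only the small function \<open>g f\<close> is left.\<close>

lemma isometric_automorphism_kernel:
  fixes x :: "'x::banach"
  assumes T: "T \<in> isometric_automorphisms" and x: "norm x = 1"
    and face: "T ` c0_face t x \<subseteq> c0_face (s::'l) y"
    and f: "apply_c0 f t = 0"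
  shows "apply_c0 (T f) s = 0"
proof -
  note T_linear = isometric_automorphismsD(1)[OF T]
  have small: "apply_c0 (T f) s = 0" if nf: "norm f \<le> 1" and f: "apply_c0 f t = 0" for f :: "('l, 'x) c0"
  proof -
    have "norm (apply_c0 (T f) s) \<le> e" if "e > 0" for e
    proof -
      let ?U = "{r. norm (apply_c0 f r) < e}"
      have "open ?U"
        by (intro open_Collect_less continuous_on_norm continuous_apply_c0 continuous_on_const)
      moreover have "t \<in> ?U" using f that by simp
      ultimately obtain g :: "('l, real) c0" where g: "apply_c0 g t = 1" "\<And>s. 0 \<le> apply_c0 g s"
          "\<And>s. apply_c0 g s \<le> 1" "\<And>s. s \<notin> ?U \<Longrightarrow> apply_c0 g s = 0"
        using c0_bump[OF lc] by blast
      let ?p = "c0_tensor g x" and ?d = "c0_mult g f"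
      have p: "?p \<in> c0_face t x"
        unfolding c0_face_def using g(1-3) x by (auto intro!: norm_c0_le)
      have "norm (apply_c0 (?p + (f - ?d)) r) \<le> 1" for r
      proof -
        have "norm (apply_c0 (f - ?d) r) = norm ((1 - apply_c0 g r) *\<^sub>R apply_c0 f r)"
          by (simp add: scaleR_left_diff_distrib)
        also have "\<dots> \<le> (1 - apply_c0 g r) * 1"
          using g(3) order_trans[OF norm_apply_c0_le nf, of r] by (simp add: mult_left_le)
        finally have "norm (apply_c0 (f - ?d) r) \<le> 1 - apply_c0 g r" by simp
        moreover have "norm (apply_c0 ?p r) = apply_c0 g r"
          using x g(2) by simp
        ultimately show ?thesis
          using norm_triangle_ineq[of "apply_c0 ?p r" "apply_c0 (f - ?d) r"]
          unfolding plus_c0.rep_eq by linarith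
      qed
      then have "?p + (f - ?d) \<in> c0_face t x"
        using g(1) f by (auto simp: c0_face_def intro: norm_c0_le)
      with p face have "T ?p \<in> c0_face s y" "T (?p + (f - ?d)) \<in> c0_face s y" by blast+
      then have "apply_c0 (T f) s = apply_c0 (T ?d) s"
        by (simp add: c0_face_def linear_add[OF T_linear] linear_diff[OF T_linear])
      moreover have "norm ?d \<le> e"
      proof (rule norm_c0_le)
        fix r show "norm (apply_c0 ?d r) \<le> e"
        proof (cases "r \<in> ?U")
          case True
          then have "apply_c0 g r * norm (apply_c0 f r) \<le> 1 * e"
            using g(2,3) by (intro mult_mono) auto
          then show ?thesis using g(2) by simp
        qed (use g(4) that in simp)
      qed
      ultimately show ?thesis
        using norm_apply_c0_le[of "T ?d" s] by (simp add: isometric_automorphismsD(3)[OF T])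
    qed
    then show ?thesis by (metis field_le_epsilon add_0 norm_le_zero_iff)
  qed
  have "norm ((1 / (norm f + 1)) *\<^sub>R f) \<le> 1"
    by (simp add: field_simps add_pos_nonneg)
  from small[OF this] f have "apply_c0 (T f) s /\<^sub>R (norm f + 1) = 0"
    by (simp add: linear_scale[OF T_linear] inverse_eq_divide)
  moreover have "norm f + 1 \<noteq> 0" using norm_ge_zero[of f] by linarith
  ultimately show ?thesis by simp
qed

text \<open>The formula is obtained for the inverse \<open>S\<close> of \<open>T\<close> and then solved for \<open>T\<close>. With \<open>s\<close> the
  point to which \<open>S\<close> moves \<open>t\<close>, evaluation of \<open>S f\<close> at \<open>s\<close> kills every \<open>f\<close> with \<open>f t = 0\<close>, so it
  factors through \<open>f t\<close>. The factor \<open>\<tau>\<close> preserves norms because \<open>S\<close> maps faces to faces, and it is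
  onto because \<open>T\<close>, too, maps faces onto faces.\<close>

proposition banach_stone_strictly_convex:
  fixes T :: "('l, 'x::banach) c0 \<Rightarrow> ('l, 'x) c0"
  assumes sc: "strictly_convex TYPE('x)" and T: "T \<in> isometric_automorphisms"
    and nontrivial: "norm (x0 :: 'x) = 1"
  obtains s \<sigma> where "\<sigma> \<in> isometric_automorphisms"
    "\<And>f. apply_c0 (T f) t = \<sigma> (apply_c0 f s)"
proof -
  let ?S = "inv T"
  have S: "?S \<in> isometric_automorphisms" by (rule isometric_automorphismsD(4)[OF T])
  note S_linear = isometric_automorphismsD(1)[OF S]
  obtain s where s: "\<And>x::'x. norm x = 1 \<Longrightarrow> \<exists>y. norm y = 1 \<and> ?S ` c0_face t x = c0_face s y"
    using isometric_automorphism_moves_points[OF sc S] by blast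
  obtain g :: "('l, real) c0" where g: "apply_c0 g t = 1" "\<And>s. 0 \<le> apply_c0 g s" "\<And>s. apply_c0 g s \<le> 1"
    using c0_bump[OF lc open_UNIV, of t] by auto
  define \<tau> where "\<tau> x = apply_c0 (?S (c0_tensor g x)) s" for x :: 'x
  have \<tau>: "apply_c0 (?S f) s = \<tau> (apply_c0 f t)" for f
  proof -
    obtain y0 where "?S ` c0_face t x0 = c0_face s y0"
      using s[OF nontrivial] by blast
    then have "apply_c0 (?S (f - c0_tensor g (apply_c0 f t))) s = 0"
      by (intro isometric_automorphism_kernel[OF S nontrivial, of t s y0]) (simp_all add: g(1))
    then show ?thesis
      by (simp add: \<tau>_def linear_diff[OF S_linear])
  qed
  have \<tau>_linear: "linear \<tau>"
    unfolding \<tau>_def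
    by (intro linear_compose[OF linear_compose[OF linear_c0_tensor_right S_linear] linear_apply_c0,
          unfolded comp_def])
  have \<tau>_face: "\<exists>y. norm y = 1 \<and> ?S ` c0_face t x = c0_face s y \<and> \<tau> x = y" if x: "norm x = 1" for x
  proof -
    obtain y where y: "norm y = 1" "?S ` c0_face t x = c0_face s y"
      using s[OF x] by blast
    obtain f where "f \<in> c0_face t x"
      using c0_face_nonempty[of x t] x by auto
    then have "apply_c0 f t = x" "?S f \<in> c0_face s y"
      using y(2) by (auto simp: c0_face_def)
    then have "\<tau> x = y" using \<tau>[of f] by (simp add: c0_face_def)
    with y show ?thesis by blast
  qed
  have \<tau>_norm: "norm (\<tau> x) = norm x" for x
  proof (cases "x = 0")
    case True
    then show ?thesis by (simp add: linear_0[OF \<tau>_linear])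
  next
    case False
    then have "norm (\<tau> (x /\<^sub>R norm x)) = 1"
      using \<tau>_face[of "x /\<^sub>R norm x"] by auto
    then show ?thesis using False by (simp add: linear_scale[OF \<tau>_linear] field_simps)
  qed
  have unit_range: "y \<in> range \<tau>" if y: "norm y = 1" for y
  proof -
    obtain r x where x: "norm x = 1" and r: "T ` c0_face s y = c0_face r x"
      using isometric_automorphism_c0_face[OF sc T y] .
    have S_face: "?S h \<in> c0_face s y" if "h \<in> c0_face r x" for h
      using that isometric_automorphismsD(6)[OF T] unfolding r[symmetric] by force
    have "r = t"
    proof (rule ccontr)
      assume "r \<noteq> t"
      (* Otherwise the face at r meets every face at t, and \<tau> is constant on the unit sphere,
         which contains both x0 and -x0. *)
      have "\<tau> z = y" if z: "norm z = 1" for z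
      proof -
        obtain h where "h \<in> c0_face r x" "h \<in> c0_face t z"
          using c0_faces_meet[OF \<open>r \<noteq> t\<close>, of x z] x z by auto
        then show ?thesis
          using S_face[of h] \<tau>[of h] by (simp add: c0_face_def)
      qed
      from this[of x0] this[of "- x0"] have "y = - y"
        using nontrivial by (simp add: linear_neg[OF \<tau>_linear])
      then have "2 *\<^sub>R y = 0" by (simp add: scaleR_2 eq_neg_iff_add_eq_0)
      with y show False by simp
    qed
    obtain h where "h \<in> c0_face r x"
      using c0_face_nonempty[of x r] x by auto
    with S_face[of h] \<tau>[of h] \<open>r = t\<close> have "\<tau> x = y"
      by (simp add: c0_face_def)
    then show ?thesis by blast
  qed
  have "surj \<tau>"
  proof (intro surjI)
    fix y
    show "\<tau> (norm y *\<^sub>R (inv \<tau> (y /\<^sub>R norm y))) = y"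
      using unit_range[of "y /\<^sub>R norm y"]
      by (cases "y = 0") (simp_all add: linear_0[OF \<tau>_linear] linear_scale[OF \<tau>_linear] f_inv_into_f)
  qed
  then have \<tau>_iso: "\<tau> \<in> isometric_automorphisms"
    using \<tau>_linear \<tau>_norm by (simp add: isometric_automorphisms_def)
  show thesis
  proof (rule that)
    show "inv \<tau> \<in> isometric_automorphisms"
      by (rule isometric_automorphismsD(4)[OF \<tau>_iso])
    fix f
    show "apply_c0 (T f) t = inv \<tau> (apply_c0 f s)"
      using \<tau>[of "T f"]
      by (simp add: isometric_automorphismsD(6)[OF T] isometric_automorphismsD(6)[OF \<tau>_iso])
  qed
qed

end

section \<open>Strictly convex values inherit convex-transitivity\<close>

lemma scaleR_mem_convex_hull_orbit:
  assumes T: "T \<in> isometric_automorphisms" and c: "0 \<le> c" "c \<le> 1"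
  shows "c *\<^sub>R T x \<in> convex hull isometry_orbit x"
proof -
  have "T x \<in> isometry_orbit x"
    using T unfolding isometry_orbit_def by blast
  moreover have "- T x \<in> isometry_orbit x"
    using uminus_isometric_automorphism[OF T] unfolding isometry_orbit_def mem_Collect_eq
    by (intro exI[of _ "\<lambda>x. - T x"]) simp
  ultimately have "((1 + c) / 2) *\<^sub>R T x + ((1 - c) / 2) *\<^sub>R (- T x) \<in> convex hull isometry_orbit x"
    using c by (intro convexD[OF convex_convex_hull] hull_inc) (auto simp: field_simps)
  also have "((1 + c) / 2) *\<^sub>R T x + ((1 - c) / 2) *\<^sub>R (- T x) = ((1 + c) / 2 - (1 - c) / 2) *\<^sub>R T x"
    by (simp only: scaleR_minus_right scaleR_left_diff_distrib add_uminus_conv_diff)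
  also have "(1 + c) / 2 - (1 - c) / 2 = c"
    by (simp add: field_simps)
  finally show ?thesis .
qed

text \<open>Evaluation at a point where the scalar factor \<open>g\<close> equals one maps the orbit of \<open>g \<otimes> x\<close> into
  the convex hull of the orbit of \<open>x\<close>, and \<open>g \<otimes> y\<close> to \<open>y\<close>.\<close>

proposition convex_transitive_of_c0:
  assumes lc: "locally_compact_space (euclidean :: 'l::t2_space topology)"
    and sc: "strictly_convex TYPE('x::banach)" and ct: "convex_transitive TYPE(('l, 'x) c0)"
  shows "convex_transitive TYPE('x)"
proof (rule convex_transitiveI)
  fix x y :: 'x assume x: "norm x = 1" and y: "norm y \<le> 1"
  fix t :: 'l
  obtain g :: "('l, real) c0" where g: "apply_c0 g t = 1" "\<And>s. 0 \<le> apply_c0 g s" "\<And>s. apply_c0 g s \<le> 1"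
    using c0_bump[OF lc open_UNIV, of t] by auto
  let ?f = "c0_tensor g x" and ?E = "\<lambda>f :: ('l, 'x) c0. apply_c0 f t"
  have "?f \<in> c0_face t x" "norm (c0_tensor g y) \<le> 1"
    unfolding c0_face_def using g x y by (auto intro!: norm_c0_le mult_le_one)
  then have "c0_tensor g y \<in> closure (convex hull isometry_orbit ?f)"
    using ct c0_face_subset_sphere[OF x, of t] unfolding convex_transitive_def by auto
  then have "?E (c0_tensor g y) \<in> closure (?E ` (convex hull isometry_orbit ?f))"
    using closure_bounded_linear_image_subset[OF bounded_linear_apply_c0] by blast
  moreover have "?E ` (convex hull isometry_orbit ?f) \<subseteq> convex hull isometry_orbit x"
  proof -
    have "?E ` isometry_orbit ?f \<subseteq> convex hull isometry_orbit x"
    proof clarify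
      fix h assume "h \<in> isometry_orbit ?f"
      then obtain T where T: "T \<in> isometric_automorphisms" and h: "h = T ?f"
        unfolding isometry_orbit_def by blast
      obtain s \<sigma> where \<sigma>: "\<sigma> \<in> isometric_automorphisms"
          and *: "\<And>f. apply_c0 (T f) t = \<sigma> (apply_c0 f s)"
        using banach_stone_strictly_convex[OF lc sc T x] by metis
      have "?E h = apply_c0 g s *\<^sub>R \<sigma> x"
        by (simp add: h * linear_scale[OF isometric_automorphismsD(1)[OF \<sigma>]])
      with scaleR_mem_convex_hull_orbit[OF \<sigma> g(2,3)] show "?E h \<in> convex hull isometry_orbit x"
        by simp
    qed
    then show ?thesis
      unfolding convex_hull_linear_image[OF linear_apply_c0] by (simp add: hull_minimal)
  qed
  ultimately have "?E (c0_tensor g y) \<in> closure (convex hull isometry_orbit x)"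
    using closure_mono by blast
  then show "y \<in> closure (convex hull isometry_orbit x)"
    using g(1) by simp
qed

section \<open>Extending automorphisms of the scalar function space to Hilbert space values\<close>

text \<open>This is the Radon--Riesz property of Hilbert spaces: weak convergence together with
  convergence of the norms is norm convergence.\<close>

lemma continuous_on_if_weak_and_norm:
  fixes f :: "'a::topological_space \<Rightarrow> 'h::real_inner"
  assumes weak: "\<And>h. continuous_on A (\<lambda>t. inner (f t) h)"
    and norm: "continuous_on A (\<lambda>t. norm (f t))"
  shows "continuous_on A f"
  unfolding continuous_on_def
proof
  fix t assume t: "t \<in> A"
  have "((\<lambda>s. (norm (f s))\<^sup>2 + (norm (f t))\<^sup>2 - 2 * inner (f s) (f t)) \<longlongrightarrow>
      (norm (f t))\<^sup>2 + (norm (f t))\<^sup>2 - 2 * inner (f t) (f t)) (at t within A)"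
  proof (intro tendsto_diff tendsto_add tendsto_mult tendsto_power tendsto_const)
    show "((\<lambda>s. inner (f s) (f t)) \<longlongrightarrow> inner (f t) (f t)) (at t within A)"
      using weak[of "f t"] t unfolding continuous_on_def by blast
    show "((\<lambda>s. norm (f s)) \<longlongrightarrow> norm (f t)) (at t within A)"
      using norm t unfolding continuous_on_def by blast
  qed
  moreover have "(norm (f s))\<^sup>2 + (norm (f t))\<^sup>2 - 2 * inner (f s) (f t) = (norm (f s - f t))\<^sup>2" for s
    by (simp add: power2_norm_eq_inner inner_diff_left inner_diff_right inner_commute)
  ultimately have "((\<lambda>s. (norm (f s - f t))\<^sup>2) \<longlongrightarrow> 0) (at t within A)"
    by (simp add: power2_norm_eq_inner)
  then have "((\<lambda>s. sqrt ((norm (f s - f t))\<^sup>2)) \<longlongrightarrow> sqrt 0) (at t within A)"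
    by (rule tendsto_real_sqrt)
  then show "(f \<longlongrightarrow> f t) (at t within A)"
    by (simp add: tendsto_norm_zero_iff LIM_zero_iff)
qed

text \<open>The inner products of the new function with fixed vectors are values of \<open>T\<close>, and so is its
  norm up to sign. They are therefore continuous in \<open>t\<close>, which makes the function itself
  continuous by the preceding lemma.\<close>

lemma weighted_composition_c0:
  fixes T :: "('l::topological_space, real) c0 \<Rightarrow> ('l, real) c0" and F :: "('l, 'h::real_inner) c0"
  assumes T: "\<And>f t. apply_c0 (T f) t = \<epsilon> t * apply_c0 f (s t)" and \<epsilon>: "\<And>t. \<bar>\<epsilon> t\<bar> = 1"
  obtains G where "\<And>t. apply_c0 G t = \<epsilon> t *\<^sub>R apply_c0 F (s t)" "norm G = norm (T (c0_norm F))"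
proof -
  let ?G = "\<lambda>t. \<epsilon> t *\<^sub>R apply_c0 F (s t)"
  have nG: "norm (?G t) = norm (apply_c0 (T (c0_norm F)) t)" for t
    by (simp add: T \<epsilon> abs_mult)
  have "vanishes_at_infinity ?G"
    using vanishes_apply_c0[of "T (c0_norm F)"]
    by (rule vanishes_at_infinity_dominated) (simp only: nG)
  moreover have "continuous_on UNIV ?G"
  proof (rule continuous_on_if_weak_and_norm)
    fix h
    have "(\<lambda>t. inner (?G t) h) = apply_c0 (T (c0_inner F h))"
      by (simp add: T fun_eq_iff)
    then show "continuous_on UNIV (\<lambda>t. inner (?G t) h)"
      by (simp only: continuous_apply_c0)
    show "continuous_on UNIV (\<lambda>t. norm (?G t))"
      unfolding nG by (intro continuous_on_norm continuous_apply_c0)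
  qed
  ultimately have G: "apply_c0 (Abs_c0 ?G) = ?G"
    by (simp add: Abs_c0_inverse)
  show thesis
  proof (rule that)
    show "apply_c0 (Abs_c0 ?G) t = ?G t" for t
      by (simp add: G)
    show "norm (Abs_c0 ?G) = norm (T (c0_norm F))"
      unfolding norm_c0_def G nG ..
  qed
qed

lemma isometric_automorphism_scalar:
  fixes T :: "('l::t2_space, real) c0 \<Rightarrow> ('l, real) c0"
  assumes lc: "locally_compact_space (euclidean :: 'l topology)" and T: "T \<in> isometric_automorphisms"
  shows "\<exists>\<epsilon> s. (\<forall>f t. apply_c0 (T f) t = \<epsilon> t * apply_c0 f (s t)) \<and> (\<forall>t. \<bar>\<epsilon> t\<bar> = 1)"
proof -
  have "\<exists>s \<epsilon>. \<bar>\<epsilon>\<bar> = 1 \<and> (\<forall>f. apply_c0 (T f) t = \<epsilon> * apply_c0 f s)" for t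
  proof -
    obtain s \<sigma> where \<sigma>: "\<sigma> \<in> isometric_automorphisms"
        and *: "\<And>f. apply_c0 (T f) t = \<sigma> (apply_c0 f s)"
      using banach_stone_strictly_convex[OF lc strictly_convex_real T norm_one] by metis
    have "\<sigma> r = \<sigma> 1 * r" for r
      using linear_scale[OF isometric_automorphismsD(1)[OF \<sigma>], of r 1] by simp
    moreover have "\<bar>\<sigma> 1\<bar> = 1"
      using isometric_automorphismsD(3)[OF \<sigma>, of 1] by simp
    ultimately show ?thesis using * by metis
  qed
  then show ?thesis by metis
qed

text \<open>The signed point map of \<open>T\<close> acts on vector-valued functions as well. The extension is onto
  because bump functions show that the signed point map of \<open>inv T\<close> inverts that of \<open>T\<close>.\<close>

lemma isometric_automorphism_extension:
  fixes T :: "('l::t2_space, real) c0 \<Rightarrow> ('l, real) c0"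
  assumes lc: "locally_compact_space (euclidean :: 'l topology)" and T: "T \<in> isometric_automorphisms"
  obtains W :: "('l, 'h::real_inner) c0 \<Rightarrow> ('l, 'h) c0"
  where "W \<in> isometric_automorphisms" "\<And>g x. W (c0_tensor g x) = c0_tensor (T g) x"
proof -
  obtain \<epsilon> s where s: "\<And>f t. apply_c0 (T f) t = \<epsilon> t * apply_c0 f (s t)" "\<And>t. \<bar>\<epsilon> t\<bar> = 1"
    using isometric_automorphism_scalar[OF lc T] by metis
  obtain \<epsilon>' s' where s': "\<And>f t. apply_c0 (inv T f) t = \<epsilon>' t * apply_c0 f (s' t)" "\<And>t. \<bar>\<epsilon>' t\<bar> = 1"
    using isometric_automorphism_scalar[OF lc isometric_automorphismsD(4)[OF T]] by metis
  have id: "s' (s t) = t \<and> \<epsilon> t * \<epsilon>' (s t) = 1" for t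
  proof -
    have *: "apply_c0 f t = \<epsilon> t * \<epsilon>' (s t) * apply_c0 f (s' (s t))" for f :: "('l, real) c0"
      using s(1)[of "inv T f" t] by (simp add: s'(1) isometric_automorphismsD(5)[OF T])
    have same: "s' (s t) = t"
    proof (rule ccontr)
      assume ne: "s' (s t) \<noteq> t"
      have "open (- {s' (s t)})" "t \<in> - {s' (s t)}"
        using ne by auto
      then obtain g :: "('l, real) c0" where "apply_c0 g t = 1" "apply_c0 g (s' (s t)) = 0"
        using c0_bump[OF lc] by (metis ComplD insertI1)
      with *[of g] show False by simp
    qed
    obtain g :: "('l, real) c0" where "apply_c0 g t = 1"
      using c0_bump[OF lc open_UNIV UNIV_I] by metis
    with *[of g] same show ?thesis by simp
  qed
  have "\<forall>F :: ('l, 'h) c0. \<exists>G :: ('l, 'h) c0.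
      (\<forall>t. apply_c0 G t = \<epsilon> t *\<^sub>R apply_c0 F (s t)) \<and> norm G = norm (T (c0_norm F))"
    by (rule allI, rule weighted_composition_c0[OF s]) blast
  then obtain W where W: "\<And>F t. apply_c0 (W F) t = \<epsilon> t *\<^sub>R apply_c0 (F :: ('l, 'h) c0) (s t)"
      "\<And>F. norm (W F) = norm (T (c0_norm F))"
    by metis
  have "\<forall>F :: ('l, 'h) c0. \<exists>G :: ('l, 'h) c0. \<forall>t. apply_c0 G t = \<epsilon>' t *\<^sub>R apply_c0 F (s' t)"
    by (rule allI, rule weighted_composition_c0[OF s']) blast
  then obtain W' where W': "\<And>F t. apply_c0 (W' F) t = \<epsilon>' t *\<^sub>R apply_c0 (F :: ('l, 'h) c0) (s' t)"
    by metis
  show thesis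
  proof (rule that)
    show "W \<in> isometric_automorphisms"
    proof (rule isometric_automorphismsI[where S = W'])
      show "linear W"
        by (intro linearI c0_eqI) (simp_all add: W scaleR_add_right)
      show "norm (W F) = norm F" for F
        by (simp add: W isometric_automorphismsD(3)[OF T] norm_c0_norm)
      show "W (W' F) = F" for F
        by (rule c0_eqI) (simp add: W W' id)
    qed
    show "W (c0_tensor g x) = c0_tensor (T g) x" for g x
      by (rule c0_eqI) (simp add: W s(1))
  qed
qed

section \<open>Straightening a Hilbert space valued function\<close>

definition reflection :: "'h::real_inner \<Rightarrow> 'h \<Rightarrow> 'h"
  where "reflection w x = x - (2 * inner x w / inner w w) *\<^sub>R w"

lemma linear_reflection: "linear (reflection w)"
  unfolding reflection_def
  by (intro linearI) (simp_all add: inner_add_left add_divide_distrib algebra_simps)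

lemma reflection_reflection:
  assumes "w \<noteq> 0"
  shows "reflection w (reflection w x) = x"
  using assms unfolding reflection_def by (simp add: inner_diff_left field_simps flip: scaleR_left_distrib)

lemma norm_reflection:
  assumes "w \<noteq> 0"
  shows "norm (reflection w x) = norm x"
proof -
  have "inner (reflection w x) (reflection w x) = inner x x"
    using assms unfolding reflection_def
    by (simp add: inner_diff_left inner_diff_right inner_commute field_simps)
  then show ?thesis by (simp add: norm_eq_sqrt_inner)
qed

lemma reflection_diff_swap:
  assumes "norm a = norm b" "a \<noteq> b"
  shows "reflection (a - b) a = b"
proof -
  have "inner a a = inner b b"
    using assms(1) by (simp add: dot_square_norm)
  then have "2 * inner a (a - b) = inner (a - b) (a - b)"
    by (simp add: inner_diff_left inner_diff_right inner_commute)
  then show ?thesis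
    using assms(2) by (simp add: reflection_def)
qed

lemma reflection_c0_automorphism:
  fixes w :: "'l::topological_space \<Rightarrow> 'h::real_inner"
  assumes w: "continuous_on UNIV w" "\<And>t. w t \<noteq> 0"
  obtains R :: "('l, 'h) c0 \<Rightarrow> ('l, 'h) c0"
  where "R \<in> isometric_automorphisms" "\<And>F t. apply_c0 (R F) t = reflection (w t) (apply_c0 F t)"
    "\<And>F. R (R F) = F"
proof -
  define R where "R F = Abs_c0 (\<lambda>t. reflection (w t) (apply_c0 F t))" for F :: "('l, 'h) c0"
  have R: "apply_c0 (R F) t = reflection (w t) (apply_c0 F t)" for F t
  proof -
    have "continuous_on UNIV (\<lambda>t. reflection (w t) (apply_c0 F t))"
      unfolding reflection_def using w by (intro continuous_intros continuous_apply_c0) auto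
    moreover have "vanishes_at_infinity (\<lambda>t. reflection (w t) (apply_c0 F t))"
      by (rule vanishes_at_infinity_dominated[OF vanishes_apply_c0[of F]]) (simp add: norm_reflection[OF w(2)])
    ultimately show ?thesis
      unfolding R_def by (simp add: Abs_c0_inverse)
  qed
  have RR: "R (R F) = F" for F
    by (rule c0_eqI) (simp add: R reflection_reflection[OF w(2)])
  have "R \<in> isometric_automorphisms"
  proof (rule isometric_automorphismsI[where S = R])
    show "linear R"
      by (intro linearI c0_eqI)
        (simp_all add: R linear_add[OF linear_reflection] linear_scale[OF linear_reflection])
    show "norm (R F) = norm F" for F
      by (simp add: norm_c0_def R norm_reflection[OF w(2)])
    show "R (R F) = F" for F by (rule RR)
  qed
  then show thesis using R RR by (rule that)
qed

text \<open>Where \<open>norm (F t) \<ge> d\<close>, the reflection along \<open>F t / norm (F t) - e\<close> turns \<open>F t\<close> into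
  \<open>norm (F t)\<close> times \<open>e\<close>. Replacing the denominator by its maximum with \<open>d\<close> extends the family of
  reflections continuously to all of the base space; the price is an error of at most \<open>2 * d\<close>, on
  the set where \<open>F\<close> is small anyway. The condition on \<open>inner (F t) e\<close> keeps the reflecting vector
  away from zero.\<close>

lemma straightening_automorphism:
  fixes F :: "('l::topological_space, 'h::real_inner) c0"
  assumes e: "norm e = 1" and d: "d > 0" and small: "\<And>t. inner (apply_c0 F t) e < d"
  obtains R where "R \<in> isometric_automorphisms" "\<And>G. R (R G) = G"
    "norm (R F - c0_tensor (c0_norm F) e) \<le> 2 * d"
proof -
  define w where "w t = apply_c0 F t /\<^sub>R max (norm (apply_c0 F t)) d - e" for t
  have pos: "max (norm (apply_c0 F t)) d > 0" for t
    using d by simp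
  have "continuous_on UNIV w"
    unfolding w_def
  proof (intro continuous_intros continuous_apply_c0 ballI)
    fix t show "max (norm (apply_c0 F t)) d \<noteq> 0" using pos[of t] by linarith
  qed
  moreover have "w t \<noteq> 0" for t
  proof
    assume "w t = 0"
    then have "inner (apply_c0 F t /\<^sub>R max (norm (apply_c0 F t)) d) e = 1"
      using e by (simp add: w_def dot_square_norm)
    then have "inner (apply_c0 F t) e = max (norm (apply_c0 F t)) d"
      using pos[of t] by (simp add: field_simps)
    with small[of t] show False by simp
  qed
  ultimately obtain R where R: "R \<in> isometric_automorphisms"
      "\<And>F t. apply_c0 (R F) t = reflection (w t) (apply_c0 F t)" "\<And>F. R (R F) = F"
    using reflection_c0_automorphism[of w] by blast
  have "norm (reflection (w t) (apply_c0 F t) - norm (apply_c0 F t) *\<^sub>R e) \<le> 2 * d" for t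
  proof (cases "norm (apply_c0 F t) \<ge> d")
    case True
    let ?u = "apply_c0 F t /\<^sub>R norm (apply_c0 F t)"
    have nz: "norm (apply_c0 F t) \<noteq> 0" using True d by linarith
    have w: "w t = ?u - e" using True by (simp add: w_def max_absorb1)
    have "reflection (w t) ?u = e"
      unfolding w using \<open>w t \<noteq> 0\<close> w nz e by (intro reflection_diff_swap) auto
    then have "reflection (w t) (norm (apply_c0 F t) *\<^sub>R ?u) = norm (apply_c0 F t) *\<^sub>R e"
      by (simp only: linear_scale[OF linear_reflection])
    then show ?thesis using nz d by simp
  next
    case False
    have "norm (reflection (w t) (apply_c0 F t) - norm (apply_c0 F t) *\<^sub>R e)
        \<le> norm (apply_c0 F t) + norm (apply_c0 F t)"
      using norm_triangle_ineq4[of "reflection (w t) (apply_c0 F t)" "norm (apply_c0 F t) *\<^sub>R e"] e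
      by (simp add: norm_reflection[OF \<open>w t \<noteq> 0\<close>])
    with False show ?thesis by linarith
  qed
  then have "norm (R F - c0_tensor (c0_norm F) e) \<le> 2 * d"
    by (intro norm_c0_le) (simp add: R(2))
  with R show thesis using that by blast
qed

text \<open>One Gram--Schmidt step per vector.\<close>

lemma orthogonal_projection_on_finite_span:
  fixes x :: "'h::real_inner"
  assumes "finite B"
  shows "\<exists>p\<in>span B. \<forall>b\<in>B. inner b (x - p) = 0"
  using assms
proof (induction B arbitrary: x rule: finite_induct)
  case empty
  then show ?case by (auto intro: span_0)
next
  case (insert b B)
  obtain q where q: "q \<in> span B" "\<And>a. a \<in> B \<Longrightarrow> inner a (b - q) = 0"
    using insert.IH[of b] by blast
  obtain p where p: "p \<in> span B" "\<And>a. a \<in> B \<Longrightarrow> inner a (x - p) = 0"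
    using insert.IH[of x] by blast
  let ?v = "b - q"
  let ?c = "inner ?v (x - p) / inner ?v ?v"
  have orth: "inner a (x - (p + ?c *\<^sub>R ?v)) = 0" if "a \<in> B" for a
    using q(2)[OF that] p(2)[OF that] by (simp add: inner_diff_right inner_add_right)
  have "orthogonal (x - (p + ?c *\<^sub>R ?v)) q"
    using q(1) orth by (intro orthogonal_to_span[of q B]) (simp_all add: orthogonal_def inner_commute)
  moreover have "inner ?v (x - (p + ?c *\<^sub>R ?v)) = 0"
    by (cases "?v = 0") (simp_all add: diff_diff_add[symmetric] inner_diff_right[of ?v "x - p"])
  ultimately have "inner b (x - (p + ?c *\<^sub>R ?v)) = 0"
    by (simp add: orthogonal_def inner_diff_left inner_commute)
  moreover have "p + ?c *\<^sub>R ?v \<in> span (insert b B)"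
    using p(1) q(1) span_mono[of B "insert b B"]
    by (intro span_add span_scale span_diff) (auto intro: span_base)
  ultimately show ?case using orth by blast
qed

lemma unit_vector_orthogonal_to_finite:
  assumes inf: "infinite_dimensional TYPE('h::real_inner)" and B: "finite (B :: 'h set)"
  obtains e where "norm e = 1" "\<And>b. b \<in> B \<Longrightarrow> inner b e = 0"
proof -
  obtain x where x: "x \<notin> span B"
    using inf B unfolding infinite_dimensional_def by blast
  obtain p where p: "p \<in> span B" "\<And>b. b \<in> B \<Longrightarrow> inner b (x - p) = 0"
    using orthogonal_projection_on_finite_span[OF B] by blast
  have "x - p \<noteq> 0" using x p by auto
  then show thesis
    using that[of "(x - p) /\<^sub>R norm (x - p)"] p(2) by simp
qed

lemma c0_range_finite_net:
  assumes "d > 0"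
  obtains B where "finite B" "\<And>t. \<exists>b\<in>B. norm (apply_c0 F t - b) < d"
proof -
  obtain K where K: "compact K" "\<And>t. t \<notin> K \<Longrightarrow> norm (apply_c0 F t) < d"
    using vanishes_at_infinityD[OF vanishes_apply_c0 assms] by blast
  have "compact (apply_c0 F ` K)"
    using K(1) continuous_on_subset[OF continuous_apply_c0] by (intro compact_continuous_image) auto
  then obtain B where B: "finite B" "apply_c0 F ` K \<subseteq> (\<Union>b\<in>B. ball b d)"
    using assms unfolding compact_eq_totally_bounded by blast
  show thesis
  proof (rule that)
    show "finite (insert 0 B)" using B(1) by simp
    fix t
    show "\<exists>b\<in>insert 0 B. norm (apply_c0 F t - b) < d"
    proof (cases "t \<in> K")
      case True
      with B(2) obtain b where "b \<in> B" "apply_c0 F t \<in> ball b d" by blast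
      then show ?thesis by (auto simp: dist_norm norm_minus_commute)
    next
      case False
      then show ?thesis using K(2) by simp
    qed
  qed
qed

lemma unit_vector_almost_orthogonal_to_ranges:
  fixes F G :: "('l::topological_space, 'h::real_inner) c0"
  assumes inf: "infinite_dimensional TYPE('h)" and d: "d > 0"
  obtains e where "norm e = 1" "\<And>t. inner (apply_c0 F t) e < d" "\<And>t. inner (apply_c0 G t) e < d"
proof -
  obtain A where A: "finite A" "\<And>t. \<exists>b\<in>A. norm (apply_c0 F t - b) < d"
    using c0_range_finite_net[OF d, of F] by blast
  obtain B where B: "finite B" "\<And>t. \<exists>b\<in>B. norm (apply_c0 G t - b) < d"
    using c0_range_finite_net[OF d, of G] by blast
  obtain e where e: "norm e = 1" "\<And>b. b \<in> A \<union> B \<Longrightarrow> inner b e = 0"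
    using unit_vector_orthogonal_to_finite[OF inf, of "A \<union> B"] A(1) B(1) by auto
  have near: "inner y e < d" if "b \<in> A \<union> B" "norm (y - b) < d" for y b
  proof -
    have "inner y e = inner (y - b) e"
      using e(2)[OF that(1)] by (simp add: inner_diff_left)
    also have "\<dots> \<le> norm (y - b)"
      using norm_cauchy_schwarz[of "y - b" e] e(1) by simp
    finally show ?thesis using that(2) by simp
  qed
  have "inner (apply_c0 F t) e < d" for t
    using A(2)[of t] near by blast
  moreover have "inner (apply_c0 G t) e < d" for t
    using B(2)[of t] near by blast
  ultimately show thesis using that e(1) by blast
qed

section \<open>Convex-transitivity of the Hilbert space valued function space\<close>

lemma c0_tensor_convex_hull_orbit:
  fixes e :: "'h::real_inner"
  assumes lc: "locally_compact_space (euclidean :: 'l::t2_space topology)"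
    and h: "h \<in> convex hull isometry_orbit (g :: ('l, real) c0)"
  shows "c0_tensor h e \<in> convex hull isometry_orbit (c0_tensor g e)"
proof -
  let ?J = "\<lambda>g. c0_tensor g e"
  have "?J ` isometry_orbit g \<subseteq> isometry_orbit (?J g)"
  proof clarify
    fix k assume "k \<in> isometry_orbit g"
    then obtain T where T: "T \<in> isometric_automorphisms" and k: "k = T g"
      unfolding isometry_orbit_def by blast
    obtain W :: "('l, 'h) c0 \<Rightarrow> ('l, 'h) c0" where "W \<in> isometric_automorphisms"
        "W (?J g) = ?J (T g)"
      using isometric_automorphism_extension[OF lc T] by metis
    then show "?J k \<in> isometry_orbit (?J g)"
      unfolding isometry_orbit_def k by (metis (mono_tags, lifting) mem_Collect_eq)
  qed
  then have "?J ` (convex hull isometry_orbit g) \<subseteq> convex hull isometry_orbit (?J g)"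
    unfolding convex_hull_linear_image[OF linear_c0_tensor_left] by (rule hull_mono)
  with h show ?thesis by blast
qed

text \<open>With reflections \<open>R\<close> and \<open>S\<close> straightening \<open>F\<close> and \<open>G\<close> towards one vector \<open>e\<close>, the
  approximation of \<open>G\<close> from the orbit of \<open>F\<close> runs through
  \<open>F \<rightarrow> R F \<approx> \<bar>F\<bar> \<otimes> e \<rightarrow> \<bar>G\<bar> \<otimes> e \<approx> S G \<rightarrow> G\<close>, where the middle step uses
  convex-transitivity for scalar functions and the last one that \<open>S\<close> is an involution.\<close>

proposition convex_transitive_c0_hilbert:
  assumes lc: "locally_compact_space (euclidean :: 'l::t2_space topology)"
    and inf: "infinite_dimensional TYPE('h::{real_inner, banach})"
    and ct: "convex_transitive TYPE(('l, real) c0)"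
  shows "convex_transitive TYPE(('l, 'h) c0)"
proof (rule convex_transitiveI)
  fix F G :: "('l, 'h) c0" assume F: "norm F = 1" and G: "norm G \<le> 1"
  show "G \<in> closure (convex hull isometry_orbit F)"
    unfolding closure_approachable
  proof (intro allI impI)
    fix r :: real assume "r > 0"
    (* The errors below add up to 5 * d. *)
    define d where "d = r / 6"
    have d: "d > 0" using \<open>r > 0\<close> by (simp add: d_def)
    obtain e :: 'h where e: "norm e = 1" "\<And>t. inner (apply_c0 F t) e < d" "\<And>t. inner (apply_c0 G t) e < d"
      using unit_vector_almost_orthogonal_to_ranges[OF inf d, of F G] by blast
    obtain R where R: "R \<in> isometric_automorphisms" "norm (R F - c0_tensor (c0_norm F) e) \<le> 2 * d"
      using straightening_automorphism[OF e(1) d e(2)] by blast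
    obtain S where S: "S \<in> isometric_automorphisms" "\<And>K. S (S K) = K"
        "norm (S G - c0_tensor (c0_norm G) e) \<le> 2 * d"
      using straightening_automorphism[OF e(1) d e(3)] by blast
    have "c0_norm G \<in> closure (convex hull isometry_orbit (c0_norm F))"
      using ct F G unfolding convex_transitive_def by (auto simp: norm_c0_norm)
    then obtain h where h: "h \<in> convex hull isometry_orbit (c0_norm F)" "dist h (c0_norm G) < d"
      using d unfolding closure_approachable by blast
    have hG: "norm (c0_tensor (c0_norm G) e - c0_tensor h e) \<le> d"
    proof -
      have "norm (c0_tensor (c0_norm G - h) e) \<le> d"
        using norm_c0_tensor_le[of "c0_norm G - h" e] h(2) e(1)
        by (simp add: dist_norm norm_minus_commute)
      then show ?thesis by (simp add: linear_diff[OF linear_c0_tensor_left])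
    qed
    obtain k where k: "k \<in> convex hull isometry_orbit (R F)" "norm (c0_tensor h e - k) \<le> 2 * d"
      using convex_hull_orbit_perturb[OF _ c0_tensor_convex_hull_orbit[OF lc h(1)], of e "R F" "2 * d"] R(2)
      by (auto simp: norm_minus_commute)
    have "k \<in> convex hull isometry_orbit F"
      using k(1) hull_mono[OF isometry_orbit_of_image_subset[OF R(1)]] by blast
    then have "S k \<in> convex hull isometry_orbit F"
      using image_convex_hull_orbit_subset[OF S(1)] by blast
    moreover have "dist (S k) G < r"
    proof -
      have "dist (S k) G = norm (S (k - S G))"
        by (simp add: dist_norm linear_diff[OF isometric_automorphismsD(1)[OF S(1)]] S(2))
      also have "\<dots> = dist (S G) k"
        by (simp add: isometric_automorphismsD(3)[OF S(1)] dist_norm norm_minus_commute)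
      also have "\<dots> \<le> dist (S G) (c0_tensor (c0_norm G) e)
          + dist (c0_tensor (c0_norm G) e) (c0_tensor h e) + dist (c0_tensor h e) k"
        using dist_triangle[of "S G" k "c0_tensor (c0_norm G) e"]
          dist_triangle[of "c0_tensor (c0_norm G) e" k "c0_tensor h e"] by linarith
      also have "\<dots> \<le> 2 * d + d + 2 * d"
        using S(3) hG k(2) by (intro add_mono) (simp_all add: dist_norm)
      also have "\<dots> < r" using d by (simp add: d_def)
      finally show ?thesis .
    qed
    ultimately show "\<exists>y\<in>convex hull isometry_orbit F. dist y G < r" by blast
  qed
qed

theorem theorem2p5:
  assumes "locally_compact_space (euclidean :: 'l::t2_space topology)"
  shows "(strictly_convex TYPE('x::banach) \<and> convex_transitive TYPE(('l, 'x) c0)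
            \<longrightarrow> convex_transitive TYPE('x))
       \<and> (infinite_dimensional TYPE('h::{real_inner, banach})
            \<and> convex_transitive TYPE(('l, real) c0)
            \<longrightarrow> convex_transitive TYPE(('l, 'h) c0))"
  using convex_transitive_of_c0[OF assms] convex_transitive_c0_hilbert[OF assms] by blast

end
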